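(* The volume 3-form $\Omega=dx_0\wedge dx_1\wedge dx_2\in\Lambda^3$ on three-dimensional phase space supposes (i.e. allows) the existence of two hamiltonian polyvector fields: a hamiltonian vector field $X_H^1\in\Lambda^1$ and a hamiltonian bivector field $X_H^2\in\Lambda^2$.
   Context: The phase space has coordinates $(x_0,x_1,x_2)$. For polyvector fields, $\Lambda^1$ denotes vector fields and $\Lambda^2$ bivector fields; for forms, $\Lambda^k$ denotes differential $k$-forms. The symbol $X\rfloor\Omega$ denotes the contraction of a polyvector field with $\Omega$; it is a 2-form if $X$ is a vector field and a 1-form if $X$ is a bivector field. A hamiltonian polyvector field is understood, as in Liouville's theorem on preservation of phase volume, as a field $X$ along which $\Omega$ has zero Lie derivative: $\mathcal L_X\Omega=X\rfloor d\Omega+d(X\rfloor\Omega)=0$. Since $d\Omega=0$, this says $d(X\rfloor\Omega)=0$, so that by Poincaré's lemma $X\rfloor\Omega=d\mathbf H$ for some form $\mathbf H$, the hamiltonian of $X$: a 1-form $\mathbf H=h_0dx_0+h_1dx_1+h_2dx_2$ (a vector hamiltonian) when $X=X_H^1$ is a vector field, and a function $H$ (a 0-form) when $X=X_H^2$ is a bivector field. *)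

theory Defs
  imports "HOL-Analysis.Analysis"
begin

text \<open>
  Polyvector fields and differential forms on \<open>\<real>\<^sup>n\<close> are given by their components with respect
  to the coordinate bases: for \<open>I = {i\<^sub>1 < \<dots> < i\<^sub>k}\<close>, the component of a form at \<open>I\<close> is its
  coefficient at \<open>dx\<^bsub>i\<^sub>1\<^esub> \<and> \<dots> \<and> dx\<^bsub>i\<^sub>k\<^esub>\<close>, and the component of a polyvector field at \<open>I\<close> is its
  coefficient at \<open>\<partial>\<^bsub>i\<^sub>1\<^esub> \<and> \<dots> \<and> \<partial>\<^bsub>i\<^sub>k\<^esub>\<close>. In particular a function is a 0-form, with its values stored
  in the component at the empty set.
\<close>

type_synonym 'n form_field = "real ^ 'n \<Rightarrow> 'n set \<Rightarrow> real"
type_synonym 'n polyvec_field = "real ^ 'n \<Rightarrow> 'n set \<Rightarrow> real"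

definition partial_deriv :: "'n::finite \<Rightarrow> (real ^ 'n \<Rightarrow> real) \<Rightarrow> real ^ 'n \<Rightarrow> real" where
  "partial_deriv i f x = frechet_derivative f (at x) (axis i 1)"

text \<open>\<open>C\<^sup>\<infinity>\<close>: differentiable, with all iterated partial derivatives differentiable.\<close>

coinductive smooth :: "(real ^ 'n::finite \<Rightarrow> real) \<Rightarrow> bool" where
  "f differentiable_on UNIV \<Longrightarrow> (\<And>i. smooth (partial_deriv i f)) \<Longrightarrow> smooth f"

definition diff_form :: "nat \<Rightarrow> 'n::finite form_field \<Rightarrow> bool" where
  "diff_form k \<omega> \<longleftrightarrow> (\<forall>I. smooth (\<lambda>x. \<omega> x I)) \<and> (\<forall>x I. card I \<noteq> k \<longrightarrow> \<omega> x I = 0)"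

definition polyvector_field :: "nat \<Rightarrow> 'n::finite polyvec_field \<Rightarrow> bool" where
  "polyvector_field k X \<longleftrightarrow> (\<forall>I. smooth (\<lambda>x. X x I)) \<and> (\<forall>x I. card I \<noteq> k \<longrightarrow> X x I = 0)"

text \<open>The sign of the permutation sorting \<open>I\<close> followed by \<open>J\<close>:
  \<open>dx\<^sub>I \<and> dx\<^sub>J = shuffle_sign I J \<cdot> dx\<^bsub>I \<union> J\<^esub>\<close> for disjoint \<open>I\<close> and \<open>J\<close>.\<close>

definition shuffle_sign :: "'n::{finite,linorder} set \<Rightarrow> 'n set \<Rightarrow> real" where
  "shuffle_sign I J = (-1) ^ card {(i, j). i \<in> I \<and> j \<in> J \<and> j < i}"

definition dx :: "'n::finite \<Rightarrow> 'n form_field" where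
  "dx i = (\<lambda>x I. if I = {i} then 1 else 0)"

definition wedge :: "'n::{finite,linorder} form_field \<Rightarrow> 'n form_field \<Rightarrow> 'n form_field"
    (infixl "\<and>\<^sub>w" 75) where
  "\<alpha> \<and>\<^sub>w \<beta> = (\<lambda>x I. \<Sum>J\<in>Pow I. shuffle_sign J (I - J) * \<alpha> x J * \<beta> x (I - J))"

text \<open>\<open>d(f dx\<^sub>J) = (\<Sum>i. \<partial>\<^sub>i f dx\<^sub>i) \<and> dx\<^sub>J\<close>, collected at \<open>I = {i} \<union> J\<close>.\<close>

definition ext_deriv :: "'n::{finite,linorder} form_field \<Rightarrow> 'n form_field" where
  "ext_deriv \<omega> = (\<lambda>x I. \<Sum>i\<in>I. shuffle_sign {i} (I - {i}) * partial_deriv i (\<lambda>y. \<omega> y (I - {i})) x)"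

text \<open>The convention is \<open>(X\<^sub>1 \<and> \<dots> \<and> X\<^sub>k) \<rfloor> \<omega> = \<omega>(X\<^sub>1, \<dots>, X\<^sub>k, \<dots>)\<close>, so that
  \<open>\<partial>\<^sub>J \<rfloor> (dx\<^sub>J \<and> dx\<^sub>K) = dx\<^sub>K\<close> for disjoint \<open>J\<close> and \<open>K\<close>.\<close>

definition contraction :: "'n::{finite,linorder} polyvec_field \<Rightarrow> 'n form_field \<Rightarrow> 'n form_field"
    (infixr "\<rfloor>" 80) where
  "X \<rfloor> \<omega> = (\<lambda>x K. \<Sum>J | J \<inter> K = {}. shuffle_sign J K * X x J * \<omega> x (J \<union> K))"

text \<open>Cartan's formula. For polyvector fields of even degree some authors give the first summand
  the opposite sign; this is immaterial for closed \<open>\<omega>\<close>.\<close>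

definition lie_deriv :: "'n::{finite,linorder} polyvec_field \<Rightarrow> 'n form_field \<Rightarrow> 'n form_field" where
  "lie_deriv X \<omega> = (\<lambda>x I. (X \<rfloor> ext_deriv \<omega>) x I + ext_deriv (X \<rfloor> \<omega>) x I)"

definition hamiltonian_field ::
    "nat \<Rightarrow> 'n::{finite,linorder} form_field \<Rightarrow> 'n polyvec_field \<Rightarrow> bool" where
  "hamiltonian_field k \<omega> X \<longleftrightarrow> polyvector_field k X \<and> lie_deriv X \<omega> = (\<lambda>x I. 0)"

text \<open>The elements of type \<open>3\<close> are \<open>0 < 1 < 2\<close>, so points of \<open>real ^ 3\<close> have
  coordinates \<open>x $ 0\<close>, \<open>x $ 1\<close>, \<open>x $ 2\<close>.\<close>

definition volume_form :: "3 form_field" ("\<Omega>") where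
  "\<Omega> = dx 0 \<and>\<^sub>w dx 1 \<and>\<^sub>w dx 2"

end

theory Submission
  imports Defs
begin

text \<open>
  Contraction with \<open>\<Omega>\<close> maps the component of \<open>X\<close> at \<open>J\<close> to plus or minus itself, placed at the
  complement of \<open>J\<close>; so it is a bijection from polyvector fields of degree \<open>k\<close> onto forms of degree
  \<open>3 - k\<close>. As \<open>\<Omega>\<close> is closed, \<open>X\<close> is hamiltonian iff \<open>X \<rfloor> \<Omega>\<close> is closed, and everything reduces to
  \<open>d \<circ> d = 0\<close> and the Poincare lemma. The homotopy operator of the latter is built from the
  radial averages \<open>P\<^sub>k f x = \<integral>\<^sub>0\<^sup>1 t\<^sup>k f (t x) dt\<close>, which satisfy \<open>\<partial>\<^sub>i (P\<^sub>k f) = P\<^bsub>k+1\<^esub> (\<partial>\<^sub>i f)\<close> and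
  \<open>(k + 1) P\<^sub>k f + (\<Sum>i. x\<^sub>i P\<^bsub>k+1\<^esub> (\<partial>\<^sub>i f)) = f\<close>; the same identities yield the symmetry of
  second derivatives needed for \<open>d \<circ> d = 0\<close>.
\<close>

section \<open>Smooth functions\<close>

lemma partial_deriv_eqI:
  assumes "(f has_derivative f') (at x)"
  shows "partial_deriv i f x = f' (axis i 1)"
  by (simp add: partial_deriv_def frechet_derivative_at[OF assms, symmetric])

lemma partial_deriv_const [simp]: "partial_deriv i (\<lambda>x. c) = (\<lambda>x. 0)"
  by (rule ext, subst partial_deriv_eqI[OF has_derivative_const]) simp

lemma partial_deriv_coord: "partial_deriv i (\<lambda>x. x $ j) = (\<lambda>x. if i = j then 1 else 0)"
  by (rule ext, subst partial_deriv_eqI[OF bounded_linear_imp_has_derivative[OF bounded_linear_vec_nth]])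
    (simp add: axis_def)

lemma partial_deriv_add:
  assumes "f differentiable (at x)" "g differentiable (at x)"
  shows "partial_deriv i (\<lambda>x. f x + g x) x = partial_deriv i f x + partial_deriv i g x"
  using partial_deriv_eqI[OF has_derivative_add[OF assms[unfolded frechet_derivative_works]]]
  by (simp add: partial_deriv_def)

lemma partial_deriv_mult:
  assumes "f differentiable (at x)" "g differentiable (at x)"
  shows "partial_deriv i (\<lambda>x. f x * g x) x = partial_deriv i f x * g x + f x * partial_deriv i g x"
  using partial_deriv_eqI[OF has_derivative_mult[OF assms[unfolded frechet_derivative_works]]]
  by (simp add: partial_deriv_def add.commute)

lemma smooth_partial_deriv [intro]: "smooth f \<Longrightarrow> smooth (partial_deriv i f)"
  by (erule smooth.cases) blast

lemma smooth_differentiable: "smooth f \<Longrightarrow> f differentiable (at x)"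
  by (erule smooth.cases) (simp add: differentiable_on_def)

lemma smooth_continuous_on: "smooth f \<Longrightarrow> continuous_on S f"
  by (meson differentiable_imp_continuous_on differentiable_at_withinI differentiable_on_def
      smooth_differentiable)

lemma smooth_const [intro, simp]: "smooth (\<lambda>x. c)"
  by (rule smooth.coinduct[where X="\<lambda>f. \<exists>c. f = (\<lambda>x. c)"]) auto

lemma smooth_coord [intro, simp]: "smooth (\<lambda>x. x $ j)"
  by (rule smooth.intros)
    (auto simp: partial_deriv_coord intro!: linear_imp_differentiable_on bounded_linear.linear)

text \<open>The product rule turns a product into a sum of products, so products alone are not
  invariant under differentiation. Closing the smooth functions under both operations gives a set
  that can serve as the invariant for coinduction.\<close>

inductive smooth_algebra :: "(real ^ 'n::finite \<Rightarrow> real) \<Rightarrow> bool" where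
  base: "smooth f \<Longrightarrow> smooth_algebra f"
| add: "smooth_algebra f \<Longrightarrow> smooth_algebra g \<Longrightarrow> smooth_algebra (\<lambda>x. f x + g x)"
| mult: "smooth_algebra f \<Longrightarrow> smooth_algebra g \<Longrightarrow> smooth_algebra (\<lambda>x. f x * g x)"

lemma smooth_algebra_step:
  "smooth_algebra f \<Longrightarrow> (\<forall>x. f differentiable (at x)) \<and> (\<forall>i. smooth_algebra (partial_deriv i f))"
proof (induction rule: smooth_algebra.induct)
  case (base f)
  then show ?case by (auto simp: smooth_differentiable smooth_algebra.base smooth_partial_deriv)
next
  case (add f g)
  then have "partial_deriv i (\<lambda>x. f x + g x) = (\<lambda>x. partial_deriv i f x + partial_deriv i g x)" for i
    by (intro ext partial_deriv_add) auto
  with add show ?case by (auto intro: smooth_algebra.intros)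
next
  case (mult f g)
  then have "partial_deriv i (\<lambda>x. f x * g x) =
      (\<lambda>x. partial_deriv i f x * g x + f x * partial_deriv i g x)" for i
    by (intro ext partial_deriv_mult) auto
  with mult show ?case by (auto intro!: smooth_algebra.add intro: smooth_algebra.mult)
qed

lemma smooth_algebra_imp_smooth: "smooth_algebra f \<Longrightarrow> smooth f"
  by (rule smooth.coinduct[where X=smooth_algebra])
    (use smooth_algebra_step in \<open>auto simp: differentiable_on_def\<close>)

lemma smooth_add [intro]: "smooth f \<Longrightarrow> smooth g \<Longrightarrow> smooth (\<lambda>x. f x + g x)"
  by (simp add: smooth_algebra.intros smooth_algebra_imp_smooth)

lemma smooth_mult [intro]: "smooth f \<Longrightarrow> smooth g \<Longrightarrow> smooth (\<lambda>x. f x * g x)"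
  by (simp add: smooth_algebra.intros smooth_algebra_imp_smooth)

lemma smooth_sum [intro]: "(\<And>a. a \<in> A \<Longrightarrow> smooth (f a)) \<Longrightarrow> smooth (\<lambda>x. \<Sum>a\<in>A. f a x)"
  by (induction A rule: infinite_finite_induct) auto

lemma partial_deriv_sum:
  assumes "\<And>a. a \<in> A \<Longrightarrow> smooth (f a)"
  shows "partial_deriv i (\<lambda>x. \<Sum>a\<in>A. f a x) x = (\<Sum>a\<in>A. partial_deriv i (f a) x)"
  using assms
  by (induction A rule: infinite_finite_induct)
    (simp_all add: partial_deriv_add smooth_differentiable smooth_sum)

lemma partial_deriv_cmult:
  assumes "smooth f"
  shows "partial_deriv i (\<lambda>x. c * f x) x = c * partial_deriv i f x"
  using partial_deriv_mult[of "\<lambda>x. c" x f i] assms by (simp add: smooth_differentiable)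

text \<open>Collecting the partial derivatives in one vector makes the derivative an inner product
  with a continuous field, the form needed to differentiate under the integral sign.\<close>

definition gradient :: "(real ^ 'n::finite \<Rightarrow> real) \<Rightarrow> real ^ 'n \<Rightarrow> real ^ 'n" where
  "gradient f x = (\<chi> i. partial_deriv i f x)"

lemma smooth_has_derivative:
  assumes "smooth f"
  shows "(f has_derivative (\<lambda>v. v \<bullet> gradient f x)) (at x)"
proof -
  let ?D = "frechet_derivative f (at x)"
  have D: "(f has_derivative ?D) (at x)"
    using smooth_differentiable[OF assms] by (simp add: frechet_derivative_works)
  then have lin: "linear ?D" by (rule has_derivative_linear)
  have "?D v = v \<bullet> gradient f x" for v
  proof -
    have "?D v = ?D (\<Sum>i\<in>UNIV. v $ i *\<^sub>R axis i 1)"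
      by (simp add: basis_expansion scalar_mult_eq_scaleR[symmetric])
    also have "\<dots> = (\<Sum>i\<in>UNIV. v $ i * partial_deriv i f x)"
      by (simp add: linear_sum[OF lin] linear_scale[OF lin] partial_deriv_def)
    finally show ?thesis by (simp add: inner_vec_def gradient_def)
  qed
  then have "?D = (\<lambda>v. v \<bullet> gradient f x)" by (rule ext)
  with D show ?thesis by simp
qed

lemma continuous_on_gradient: "smooth f \<Longrightarrow> continuous_on S (gradient f)"
  unfolding gradient_def
  by (intro continuous_on_vec_lambda smooth_continuous_on smooth_partial_deriv)

lemma has_derivative_translate:
  assumes "smooth f"
  shows "((\<lambda>x. f (x + a)) has_derivative (\<lambda>v. v \<bullet> gradient f (x + a))) (at x)"
  by (rule has_derivative_compose[of "\<lambda>x. x + a" "\<lambda>v. v" x UNIV f, simplified])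
    (auto intro!: derivative_eq_intros smooth_has_derivative assms)

lemma partial_deriv_translate:
  "smooth f \<Longrightarrow> partial_deriv i (\<lambda>x. f (x + a)) = (\<lambda>x. partial_deriv i f (x + a))"
  by (rule ext) (simp add: partial_deriv_eqI[OF has_derivative_translate] inner_axis' gradient_def)

text \<open>Partial differentiation commutes with translation, so the translates of smooth functions
  are invariant under it. This carries pointwise facts from the origin to any point.\<close>

lemma smooth_translate: "smooth f \<Longrightarrow> smooth (\<lambda>x. f (x + a))"
proof (rule smooth.coinduct[where X="\<lambda>g. \<exists>f. smooth f \<and> g = (\<lambda>x. f (x + a))"], blast)
  fix g assume "\<exists>f. smooth f \<and> g = (\<lambda>x. f (x + a))"
  then obtain f where f: "smooth f" and g: "g = (\<lambda>x. f (x + a))" by blast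
  have "g differentiable (at x)" for x
    using has_derivative_translate[OF f] unfolding g differentiable_def by blast
  moreover have "\<exists>h. smooth h \<and> partial_deriv i g = (\<lambda>x. h (x + a))" for i
    using f unfolding g partial_deriv_translate[OF f] by blast
  ultimately show "\<exists>f. g = f \<and> f differentiable_on UNIV \<and>
      (\<forall>i. (\<exists>h. smooth h \<and> partial_deriv i f = (\<lambda>x. h (x + a))) \<or> smooth (partial_deriv i f))"
    by (auto simp: differentiable_on_def)
qed

section \<open>Radial averages\<close>

definition radial_avg :: "nat \<Rightarrow> (real ^ 'n::finite \<Rightarrow> real) \<Rightarrow> real ^ 'n \<Rightarrow> real" where
  "radial_avg k f x = integral {0..1} (\<lambda>t. t ^ k * f (t *\<^sub>R x))"

lemma continuous_on_radial:
  "smooth f \<Longrightarrow> continuous_on {0..1} (\<lambda>t::real. t ^ k * f (t *\<^sub>R x))"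
  by (intro continuous_intros continuous_on_compose2[OF smooth_continuous_on[of f UNIV]]) auto

lemma integrable_radial:
  "smooth f \<Longrightarrow> (\<lambda>t::real. t ^ k * f (t *\<^sub>R x)) integrable_on {0..1}"
  by (intro integrable_continuous_interval continuous_on_radial)

text \<open>Differentiation under the integral sign; the chain rule for
  \<open>f (t *\<^sub>R x)\<close> yields one more factor \<open>t\<close>, which raises the weight
  to \<open>Suc k\<close>.\<close>

lemma has_derivative_radial_avg:
  assumes "smooth f"
  shows "(radial_avg k f has_derivative (\<lambda>v. v \<bullet> (\<chi> i. radial_avg (Suc k) (partial_deriv i f) x))) (at x)"
proof -
  let ?g = "\<lambda>x t. t ^ Suc k *\<^sub>R gradient f (t *\<^sub>R x)"
  have cont: "continuous_on S (\<lambda>p. ?g (fst p) (snd p))" for S :: "((real^'a) \<times> real) set"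
    by (intro continuous_intros continuous_on_compose2[OF continuous_on_gradient[OF assms, of UNIV]]) auto
  have cont_t: "continuous_on {0..1} (?g x)" for x
    by (intro continuous_intros continuous_on_compose2[OF continuous_on_gradient[OF assms, of UNIV]]) auto
  have "((\<lambda>x. integral (cbox 0 1) (\<lambda>t. t ^ k * f (t *\<^sub>R x))) has_derivative
      integral (cbox 0 1) (\<lambda>t. blinfun_inner_left (?g x t))) (at x within UNIV)"
  proof (rule leibniz_rule)
    fix x :: "real^'a" and t :: real
    have "((\<lambda>x. f (t *\<^sub>R x)) has_derivative (\<lambda>v. (t *\<^sub>R v) \<bullet> gradient f (t *\<^sub>R x))) (at x)"
      by (rule has_derivative_compose[of "\<lambda>x. t *\<^sub>R x" "\<lambda>v. t *\<^sub>R v" x UNIV f, simplified])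
        (auto intro!: derivative_eq_intros smooth_has_derivative assms)
    then show "((\<lambda>x. t ^ k * f (t *\<^sub>R x)) has_derivative blinfun_apply (blinfun_inner_left (?g x t)))
        (at x within UNIV)"
      by (auto intro!: derivative_eq_intros simp: algebra_simps)
  next
    show "(\<lambda>t. t ^ k * f (t *\<^sub>R x)) integrable_on cbox 0 1" for x
      using integrable_radial[OF assms] by simp
    show "continuous_on (UNIV \<times> cbox 0 1) (\<lambda>(x, t). blinfun_inner_left (?g x t))"
      unfolding split_beta
      by (intro bounded_linear.continuous_on[OF bounded_linear_blinfun_inner_left] cont)
  qed auto
  \<comment> \<open>The Leibniz rule integrates operator-valued derivatives. Pulling the bounded
    linear map \<open>blinfun_inner_left\<close> out of the integral leaves the inner product with
    the integrated gradient.\<close>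
  moreover have "integral (cbox 0 1) (\<lambda>t. blinfun_inner_left (?g x t)) =
      blinfun_inner_left (integral {0..1} (?g x))"
    using integral_linear[OF integrable_continuous_interval[OF cont_t] bounded_linear_blinfun_inner_left]
    by (simp add: o_def)
  moreover have "integral {0..1} (?g x) = (\<chi> i. radial_avg (Suc k) (partial_deriv i f) x)"
  proof (rule vec_eq_iff[THEN iffD2], rule allI)
    fix i
    have "integral {0..1} (?g x) $ i = integral {0..1} (\<lambda>t. ?g x t $ i)"
      using integral_linear[OF integrable_continuous_interval[OF cont_t] bounded_linear_vec_nth[of i], of x]
      by (simp add: o_def)
    then show "integral {0..1} (?g x) $ i = (\<chi> i. radial_avg (Suc k) (partial_deriv i f) x) $ i"
      by (simp add: radial_avg_def gradient_def)
  qed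
  ultimately show ?thesis
    by (simp add: radial_avg_def[abs_def])
qed

lemma partial_deriv_radial_avg:
  "smooth f \<Longrightarrow> partial_deriv i (radial_avg k f) = radial_avg (Suc k) (partial_deriv i f)"
  by (rule ext) (simp add: partial_deriv_eqI[OF has_derivative_radial_avg] inner_axis')

text \<open>The coinduction ranges over all weights at once, since each derivative increases the
  weight.\<close>

lemma smooth_radial_avg [intro]: "smooth f \<Longrightarrow> smooth (radial_avg k f)"
proof (rule smooth.coinduct[where X="\<lambda>g. \<exists>k f. smooth f \<and> g = radial_avg k f"], blast)
  fix g :: "real^'a \<Rightarrow> real" assume "\<exists>k f. smooth f \<and> g = radial_avg k f"
  then obtain k f where f: "smooth f" and g: "g = radial_avg k f" by blast
  have "g differentiable_on UNIV"
    using has_derivative_radial_avg[OF f] unfolding g differentiable_on_def differentiable_def by blast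
  moreover have "\<exists>k' f'. smooth f' \<and> partial_deriv i g = radial_avg k' f'" for i
    using f unfolding g partial_deriv_radial_avg[OF f] by blast
  ultimately show "\<exists>f. g = f \<and> f differentiable_on UNIV \<and>
      (\<forall>i. (\<exists>k' f'. smooth f' \<and> partial_deriv i f = radial_avg k' f') \<or> smooth (partial_deriv i f))"
    by auto
qed

text \<open>Integrate the \<open>t\<close>-derivative of
  \<open>t ^ Suc k * f (t *\<^sub>R x)\<close> over the unit interval: the positive power kills the
  boundary term at 0, and the one at 1 is \<open>f x\<close>.\<close>

lemma radial_avg_identity:
  assumes "smooth f"
  shows "real (Suc k) * radial_avg k f x + (\<Sum>i\<in>UNIV. x $ i * radial_avg (Suc k) (partial_deriv i f) x) = f x"
proof -
  have "((\<lambda>t. t ^ Suc k * f (t *\<^sub>R x)) has_vector_derivative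
      real (Suc k) * (t ^ k * f (t *\<^sub>R x)) + (\<Sum>i\<in>UNIV. x $ i * (t ^ Suc k * partial_deriv i f (t *\<^sub>R x))))
      (at t within {0..1})" for t
  proof -
    have "((\<lambda>t. f (t *\<^sub>R x)) has_derivative (\<lambda>s. (s *\<^sub>R x) \<bullet> gradient f (t *\<^sub>R x))) (at t within {0..1})"
      by (rule has_derivative_compose[of "\<lambda>t. t *\<^sub>R x" "\<lambda>s. s *\<^sub>R x" t "{0..1}" f])
        (auto intro!: derivative_eq_intros smooth_has_derivative assms)
    then have "((\<lambda>t. f (t *\<^sub>R x)) has_real_derivative (x \<bullet> gradient f (t *\<^sub>R x))) (at t within {0..1})"
      by (simp add: has_field_derivative_def mult.commute mult_commute_abs)
    then have "((\<lambda>t. t ^ Suc k * f (t *\<^sub>R x)) has_real_derivative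
        real (Suc k) * t ^ k * f (t *\<^sub>R x) + t ^ Suc k * (x \<bullet> gradient f (t *\<^sub>R x))) (at t within {0..1})"
      by (auto intro!: derivative_eq_intros simp del: power_Suc)
    then show ?thesis
      unfolding has_real_derivative_iff_has_vector_derivative[symmetric]
      by (simp add: inner_vec_def gradient_def sum_distrib_left mult_ac)
  qed
  then have "((\<lambda>t. real (Suc k) * (t ^ k * f (t *\<^sub>R x)) +
      (\<Sum>i\<in>UNIV. x $ i * (t ^ Suc k * partial_deriv i f (t *\<^sub>R x)))) has_integral f x) {0..1}"
    using fundamental_theorem_of_calculus[of 0 1 "\<lambda>t. t ^ Suc k * f (t *\<^sub>R x)"] by simp
  moreover have "((\<lambda>t. real (Suc k) * (t ^ k * f (t *\<^sub>R x)) +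
      (\<Sum>i\<in>UNIV. x $ i * (t ^ Suc k * partial_deriv i f (t *\<^sub>R x)))) has_integral
      real (Suc k) * radial_avg k f x + (\<Sum>i\<in>UNIV. x $ i * radial_avg (Suc k) (partial_deriv i f) x)) {0..1}"
    unfolding radial_avg_def
    by (intro has_integral_add has_integral_mult_right has_integral_sum integrable_integral
        integrable_radial smooth_partial_deriv assms) auto
  ultimately show ?thesis by (rule has_integral_unique[rotated])
qed

lemma radial_avg_linear:
  assumes "finite A" "\<And>a. a \<in> A \<Longrightarrow> smooth (f a)"
  shows "radial_avg k (\<lambda>x. \<Sum>a\<in>A. c a * f a x) x = (\<Sum>a\<in>A. c a * radial_avg k (f a) x)"
proof -
  have "((\<lambda>t. \<Sum>a\<in>A. c a * (t ^ k * f a (t *\<^sub>R x))) has_integral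
      (\<Sum>a\<in>A. c a * radial_avg k (f a) x)) {0..1}"
    unfolding radial_avg_def
    by (intro has_integral_mult_right has_integral_sum integrable_integral integrable_radial assms)
  then show ?thesis
    unfolding radial_avg_def by (simp add: integral_unique sum_distrib_left mult_ac)
qed


section \<open>Symmetry of second derivatives\<close>

lemma partial_deriv_coord_sum:
  assumes "finite A" "\<And>i. i \<in> A \<Longrightarrow> smooth (g i)"
  shows "partial_deriv j (\<lambda>x. \<Sum>i\<in>A. x $ i * g i x) x =
    (if j \<in> A then g j x else 0) + (\<Sum>i\<in>A. x $ i * partial_deriv j (g i) x)"
proof -
  have "partial_deriv j (\<lambda>x. \<Sum>i\<in>A. x $ i * g i x) x =
      (\<Sum>i\<in>A. (if j = i then g i x else 0) + x $ i * partial_deriv j (g i) x)"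
    using assms
    by (subst partial_deriv_sum)
      (auto intro!: sum.cong simp: partial_deriv_mult smooth_differentiable partial_deriv_coord)
  then show ?thesis
    using assms(1) by (simp add: sum.distrib)
qed

text \<open>Differentiating \<open>f = P\<^sub>0 f + (\<Sum>l. x\<^sub>l P\<^sub>1 (\<partial>\<^sub>l f))\<close> in direction \<open>j\<close> and comparing with
  \<open>\<partial>\<^sub>j f = 2 P\<^sub>1 (\<partial>\<^sub>j f) + (\<Sum>l. x\<^sub>l P\<^sub>2 (\<partial>\<^sub>l \<partial>\<^sub>j f))\<close>, where \<open>P\<^sub>k\<close> is \<^const>\<open>radial_avg\<close>, gives
  \<open>(\<Sum>l. x\<^sub>l P\<^sub>2 (\<partial>\<^sub>j \<partial>\<^sub>l f - \<partial>\<^sub>l \<partial>\<^sub>j f)) = 0\<close>; the \<open>i\<close>-th derivative of this at \<open>0\<close> is the claim.\<close>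

lemma partial_deriv_commute_at_0:
  assumes f: "smooth f"
  shows "partial_deriv i (partial_deriv j f) 0 = partial_deriv j (partial_deriv i f) 0"
proof -
  \<comment> \<open>At the origin every summand \<open>x $ i * _\<close> of the radial identity
    vanishes, so averaging with weight 2 only divides by 3 and can be undone.\<close>
  have at_0: "3 * radial_avg 2 h 0 = h 0" if "smooth h" for h :: "real ^ 'a \<Rightarrow> real"
    using radial_avg_identity[OF that, of 2 0] by simp
  have eq: "(\<Sum>l\<in>UNIV. x $ l * radial_avg 2 (partial_deriv j (partial_deriv l f)) x) =
      (\<Sum>l\<in>UNIV. x $ l * radial_avg 2 (partial_deriv l (partial_deriv j f)) x)" for x
  proof -
    have "f = (\<lambda>x. radial_avg 0 f x + (\<Sum>l\<in>UNIV. x $ l * radial_avg 1 (partial_deriv l f) x))"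
      using radial_avg_identity[OF f, of 0] by simp
    then have "partial_deriv j f x = partial_deriv j
        (\<lambda>x. radial_avg 0 f x + (\<Sum>l\<in>UNIV. x $ l * radial_avg 1 (partial_deriv l f) x)) x"
      by (rule arg_cong)
    also have "\<dots> = partial_deriv j (radial_avg 0 f) x +
        partial_deriv j (\<lambda>x. \<Sum>l\<in>UNIV. x $ l * radial_avg 1 (partial_deriv l f) x) x"
      using f by (intro partial_deriv_add smooth_differentiable smooth_sum smooth_mult smooth_coord) auto
    also have "\<dots> = 2 * radial_avg 1 (partial_deriv j f) x +
        (\<Sum>l\<in>UNIV. x $ l * radial_avg 2 (partial_deriv j (partial_deriv l f)) x)"
      using f by (subst partial_deriv_coord_sum)
        (auto simp: partial_deriv_radial_avg smooth_partial_deriv numeral_2_eq_2)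
    finally show ?thesis
      using radial_avg_identity[OF smooth_partial_deriv[OF f], of 1 j x] by (simp add: numeral_2_eq_2)
  qed
  have "partial_deriv i (\<lambda>x. \<Sum>l\<in>UNIV. x $ l * radial_avg 2 (partial_deriv j (partial_deriv l f)) x) 0 =
      partial_deriv i (\<lambda>x. \<Sum>l\<in>UNIV. x $ l * radial_avg 2 (partial_deriv l (partial_deriv j f)) x) 0"
    by (simp only: eq)
  then have "radial_avg 2 (partial_deriv j (partial_deriv i f)) 0 =
      radial_avg 2 (partial_deriv i (partial_deriv j f)) 0"
    using f by (subst (asm) (1 2) partial_deriv_coord_sum) auto
  then show ?thesis
    using at_0 f by (metis smooth_partial_deriv)
qed

lemma partial_deriv_commute:
  assumes "smooth f"
  shows "partial_deriv i (partial_deriv j f) x = partial_deriv j (partial_deriv i f) x"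
  using partial_deriv_commute_at_0[OF smooth_translate[OF assms, of x], of i j]
  by (simp add: partial_deriv_translate assms smooth_partial_deriv)

section \<open>The exterior derivative\<close>

lemma shuffle_sign_singleton: "shuffle_sign {i} J = (-1) ^ card {j \<in> J. j < i}"
proof -
  have "{(a, b). a \<in> {i} \<and> b \<in> J \<and> b < a} = Pair i ` {j \<in> J. j < i}" by auto
  then show ?thesis by (simp add: shuffle_sign_def card_image inj_on_def)
qed

lemma shuffle_sign_insert:
  "j \<notin> J \<Longrightarrow> shuffle_sign {i} (insert j J) = shuffle_sign {i} {j} * shuffle_sign {i} J"
proof -
  assume "j \<notin> J"
  then have "{a \<in> insert j J. a < i} =
      (if j < i then insert j {a \<in> J. a < i} else {a \<in> J. a < i})"
    and "{a \<in> {j}. a < i} = (if j < i then {j} else {})" by auto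
  with \<open>j \<notin> J\<close> show ?thesis by (simp add: shuffle_sign_singleton)
qed

lemma shuffle_sign_swap: "i \<noteq> j \<Longrightarrow> shuffle_sign {i} {j} = - shuffle_sign {j} {i}"
proof -
  have "{a \<in> {j}. a < i} = (if j < i then {j} else {})" for i j :: 'a by auto
  then show "i \<noteq> j \<Longrightarrow> ?thesis" by (auto simp: shuffle_sign_singleton)
qed

lemma shuffle_sign_square: "shuffle_sign I J * shuffle_sign I J = 1"
  by (simp add: shuffle_sign_def flip: power_add)

section \<open>Degree of the exterior derivative, and d d = 0\<close>

lemma diff_form_ext_deriv:
  assumes "diff_form k \<omega>"
  shows "diff_form (Suc k) (ext_deriv \<omega>)"
  unfolding diff_form_def
proof (intro conjI allI impI)
  show "smooth (\<lambda>x. ext_deriv \<omega> x I)" for I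
    using assms unfolding ext_deriv_def diff_form_def
    by (intro smooth_sum smooth_mult smooth_const smooth_partial_deriv) blast
  show "ext_deriv \<omega> x I = 0" if "card I \<noteq> Suc k" for x I
  proof -
    have "(\<lambda>y. \<omega> y (I - {i})) = (\<lambda>y. 0)" if "i \<in> I" for i
    proof -
      have "card (I - {i}) \<noteq> k"
        using that \<open>card I \<noteq> Suc k\<close> card_Suc_Diff1[of I i] by auto
      with assms show ?thesis by (auto simp: diff_form_def)
    qed
    then show ?thesis by (simp add: ext_deriv_def)
  qed
qed

text \<open>The component at \<open>I\<close> is a sum over ordered pairs of distinct indices.
  Exchanging the two indices flips the sign factor and preserves the second derivative, so the sum
  cancels.\<close>

lemma ext_deriv_ext_deriv:
  assumes "diff_form k \<omega>"
  shows "ext_deriv (ext_deriv \<omega>) = (\<lambda>x I. 0)"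
proof (intro ext)
  fix x I
  have smooth: "smooth (\<lambda>y. \<omega> y J)" for J
    using assms by (simp add: diff_form_def)
  \<comment> \<open>The zero diagonal lets the inner sum run over all of \<open>I\<close>, so that
    the two sums can be swapped.\<close>
  define a where "a i j = (if i = j then 0 else shuffle_sign {i} (I - {i}) *
    (shuffle_sign {j} (I - {i} - {j}) *
      partial_deriv i (partial_deriv j (\<lambda>y. \<omega> y (I - {i} - {j}))) x))" for i j
  have antisym: "a i j = - a j i" if "i \<in> I" "j \<in> I" for i j
  proof (cases "i = j")
    case False
    define J where "J = I - {i} - {j}"
    have J: "I - {i} = insert j J" "I - {j} = insert i J"
        "insert j J - {j} = J" "insert i J - {i} = J" "i \<notin> J" "j \<notin> J"
      using that False by (auto simp: J_def)
    have "a i j = shuffle_sign {i} {j} * shuffle_sign {i} J * (shuffle_sign {j} J *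
        partial_deriv i (partial_deriv j (\<lambda>y. \<omega> y J)) x)"
      by (simp only: a_def J if_False False shuffle_sign_insert not_False_eq_True)
    moreover have "a j i = shuffle_sign {j} {i} * shuffle_sign {j} J * (shuffle_sign {i} J *
        partial_deriv j (partial_deriv i (\<lambda>y. \<omega> y J)) x)"
      by (simp only: a_def J if_False False[symmetric] shuffle_sign_insert not_False_eq_True)
    ultimately show ?thesis
      using partial_deriv_commute[OF smooth, of i j J x] shuffle_sign_swap[OF False] by simp
  qed (simp add: a_def)
  have "ext_deriv (ext_deriv \<omega>) x I = (\<Sum>i\<in>I. \<Sum>j\<in>I - {i}. a i j)"
    unfolding ext_deriv_def
  proof (rule sum.cong[OF refl])
    fix i assume "i \<in> I"
    have "partial_deriv i (\<lambda>y. \<Sum>j\<in>I - {i}. shuffle_sign {j} (I - {i} - {j}) *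
        partial_deriv j (\<lambda>y. \<omega> y (I - {i} - {j})) y) x =
      (\<Sum>j\<in>I - {i}. shuffle_sign {j} (I - {i} - {j}) *
        partial_deriv i (partial_deriv j (\<lambda>y. \<omega> y (I - {i} - {j}))) x)"
      by (subst partial_deriv_sum)
        (simp_all add: partial_deriv_cmult smooth smooth_partial_deriv smooth_mult)
    then show "shuffle_sign {i} (I - {i}) * partial_deriv i
        (\<lambda>y. \<Sum>j\<in>I - {i}. shuffle_sign {j} (I - {i} - {j}) *
          partial_deriv j (\<lambda>y. \<omega> y (I - {i} - {j})) y) x = (\<Sum>j\<in>I - {i}. a i j)"
      by (simp only: sum_distrib_left) (rule sum.cong, auto simp: a_def)
  qed
  also have "\<dots> = (\<Sum>i\<in>I. \<Sum>j\<in>I. a i j)"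
    by (intro sum.cong sum.mono_neutral_left refl) (auto simp: a_def)
  finally have 1: "ext_deriv (ext_deriv \<omega>) x I = (\<Sum>i\<in>I. \<Sum>j\<in>I. a i j)" .
  have "(\<Sum>i\<in>I. \<Sum>j\<in>I. a i j) = (\<Sum>j\<in>I. \<Sum>i\<in>I. - a j i)"
    by (subst sum.swap) (intro sum.cong refl antisym)
  also have "\<dots> = - (\<Sum>i\<in>I. \<Sum>j\<in>I. a i j)"
    by (simp only: sum_negf)
  finally show "ext_deriv (ext_deriv \<omega>) x I = 0"
    unfolding 1 by linarith
qed

section \<open>The Poincare lemma\<close>

text \<open>This is contraction with the Euler field, whose components are the coordinates, followed
  by averaging along rays. The weight \<open>t ^ k\<close> is what pulling back a form of degree
  \<open>k + 1\<close> along \<open>x -> t x\<close> leaves after that contraction.\<close>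

definition cone_op :: "nat \<Rightarrow> 'n::{finite,linorder} form_field \<Rightarrow> 'n form_field" where
  "cone_op k \<omega> = (\<lambda>x K. \<Sum>i\<in>-K. x $ i *
    (shuffle_sign {i} K * radial_avg k (\<lambda>y. \<omega> y (insert i K)) x))"

lemma diff_form_cone_op:
  assumes "diff_form (Suc k) \<omega>"
  shows "diff_form k (cone_op k \<omega>)"
  unfolding diff_form_def
proof (intro conjI allI impI)
  show "smooth (\<lambda>x. cone_op k \<omega> x K)" for K
    using assms unfolding cone_op_def diff_form_def
    by (intro smooth_sum smooth_mult smooth_coord smooth_const smooth_radial_avg) blast
  show "cone_op k \<omega> x K = 0" if "card K \<noteq> k" for x K
  proof -
    have "radial_avg k (\<lambda>y. \<omega> y (insert i K)) x = 0" if "i \<in> - K" for i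
      using that \<open>card K \<noteq> k\<close> assms by (simp add: diff_form_def radial_avg_def)
    then show ?thesis by (simp add: cone_op_def)
  qed
qed

text \<open>Expanding the left side at \<open>I\<close> gives \<open>Suc k\<close> radial averages
  and the terms \<open>x $ i * ?P i I\<close> for \<open>i\<close> in \<open>I\<close>. Closedness
  supplies the same terms for \<open>i\<close> outside \<open>I\<close>, and
  \<open>radial_avg_identity\<close> sums everything up.\<close>

lemma poincare_lemma:
  assumes \<omega>: "diff_form (Suc k) \<omega>" and closed: "ext_deriv \<omega> = (\<lambda>x I. 0)"
  shows "ext_deriv (cone_op k \<omega>) = \<omega>"
proof (intro ext)
  fix x I
  have smooth: "smooth (\<lambda>y. \<omega> y J)" for J
    using \<omega> by (simp add: diff_form_def)
  let ?P = "\<lambda>i J. radial_avg (Suc k) (partial_deriv i (\<lambda>y. \<omega> y J)) x"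
  show "ext_deriv (cone_op k \<omega>) x I = \<omega> x I"
  proof (cases "card I = Suc k")
    case False
    with \<omega> diff_form_ext_deriv[OF diff_form_cone_op[OF \<omega>]] show ?thesis
      by (simp add: diff_form_def)
  next
    case True
    \<comment> \<open>The coordinates occurring in the component at \<open>I - {i}\<close> are
      \<open>i\<close> itself and those outside \<open>I\<close>. The coordinate \<open>i\<close>
      produces the first two terms, where its sign appears squared.\<close>
    have inner: "shuffle_sign {i} (I - {i}) * partial_deriv i (\<lambda>y. cone_op k \<omega> y (I - {i})) x =
        radial_avg k (\<lambda>y. \<omega> y I) x + x $ i * ?P i I +
        (\<Sum>j\<in>-I. x $ j * (shuffle_sign {i} (I - {i}) * shuffle_sign {j} (I - {i}) *
          ?P i (insert j (I - {i}))))" if "i \<in> I" for i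
    proof -
      have *: "- (I - {i}) = insert i (- I)" "i \<notin> - I" "insert i (I - {i}) = I" using that by auto
      have "partial_deriv i (\<lambda>y. cone_op k \<omega> y (I - {i})) x =
          shuffle_sign {i} (I - {i}) * radial_avg k (\<lambda>y. \<omega> y I) x +
          (\<Sum>j\<in>insert i (- I). x $ j * (shuffle_sign {j} (I - {i}) * ?P i (insert j (I - {i}))))"
        unfolding cone_op_def *(1)
        by (subst partial_deriv_coord_sum)
          (simp_all add: * that insert_absorb smooth smooth_mult smooth_radial_avg
            partial_deriv_cmult partial_deriv_radial_avg)
      also have "\<dots> = shuffle_sign {i} (I - {i}) * (radial_avg k (\<lambda>y. \<omega> y I) x + x $ i * ?P i I) +
          (\<Sum>j\<in>-I. x $ j * (shuffle_sign {j} (I - {i}) * ?P i (insert j (I - {i}))))"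
        using * by (simp add: algebra_simps)
      finally show ?thesis
        using shuffle_sign_square[of "{i}" "I - {i}"]
        by (simp add: distrib_left sum_distrib_left mult.assoc[symmetric])
          (simp add: mult_ac)
    qed
    have cross: "(\<Sum>i\<in>I. shuffle_sign {i} (I - {i}) * shuffle_sign {j} (I - {i}) *
        ?P i (insert j (I - {i}))) = ?P j I" if "j \<notin> I" for j
    proof -
      \<comment> \<open>Splitting off \<open>i\<close> on one side and \<open>j\<close> on the other
        leaves the sign of the pair squared; the minus from \<open>shuffle_sign_swap\<close> offsets
        the one in the claim.\<close>
      have sign: "shuffle_sign {i} (I - {i}) * shuffle_sign {j} (I - {i}) =
          - shuffle_sign {j} I * shuffle_sign {i} (insert j (I - {i}))" if "i \<in> I" for i
      proof -
        have "i \<noteq> j" using that \<open>j \<notin> I\<close> by auto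
        have "shuffle_sign {j} I = shuffle_sign {j} {i} * shuffle_sign {j} (I - {i})"
          using shuffle_sign_insert[of i "I - {i}" j] that by (simp add: insert_absorb)
        moreover have "shuffle_sign {i} (insert j (I - {i})) =
            - shuffle_sign {j} {i} * shuffle_sign {i} (I - {i})"
          using shuffle_sign_insert[of j "I - {i}" i] shuffle_sign_swap[OF \<open>i \<noteq> j\<close>] \<open>j \<notin> I\<close> by simp
        moreover have "shuffle_sign {j} {i} * shuffle_sign {j} {i} = 1"
          by (rule shuffle_sign_square)
        ultimately show ?thesis by algebra
      qed
      \<comment> \<open>This is closedness at \<open>insert j I\<close> with the summand for
        \<open>j\<close> moved to the right. It holds at every point \<open>z\<close>, so it can be
        used under the radial average.\<close>
      have closed_at: "(\<Sum>i\<in>I. shuffle_sign {i} (insert j (I - {i})) *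
          partial_deriv i (\<lambda>y. \<omega> y (insert j (I - {i}))) z) =
          - shuffle_sign {j} I * partial_deriv j (\<lambda>y. \<omega> y I) z" for z
      proof -
        have "(\<Sum>i\<in>I. shuffle_sign {i} (insert j I - {i}) *
            partial_deriv i (\<lambda>y. \<omega> y (insert j I - {i})) z) =
            - shuffle_sign {j} I * partial_deriv j (\<lambda>y. \<omega> y I) z"
          using fun_cong[OF fun_cong[OF closed], of z "insert j I"] that
          by (simp add: ext_deriv_def)
        moreover have "insert j I - {i} = insert j (I - {i})" if "i \<in> I" for i
          using that \<open>j \<notin> I\<close> by auto
        ultimately show ?thesis by simp
      qed
      have "(\<Sum>i\<in>I. shuffle_sign {i} (I - {i}) * shuffle_sign {j} (I - {i}) *
          ?P i (insert j (I - {i}))) =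
        - shuffle_sign {j} I * (\<Sum>i\<in>I. shuffle_sign {i} (insert j (I - {i})) *
          ?P i (insert j (I - {i})))"
        by (simp add: sign sum_distrib_left mult.assoc)
      also have "(\<Sum>i\<in>I. shuffle_sign {i} (insert j (I - {i})) * ?P i (insert j (I - {i}))) =
          radial_avg (Suc k) (\<lambda>z. \<Sum>i\<in>I. shuffle_sign {i} (insert j (I - {i})) *
            partial_deriv i (\<lambda>y. \<omega> y (insert j (I - {i}))) z) x"
        by (rule radial_avg_linear[symmetric]) (auto intro: smooth_partial_deriv smooth)
      also have "\<dots> = - shuffle_sign {j} I * ?P j I"
        unfolding closed_at
        using radial_avg_linear[of "{j}" "\<lambda>j. partial_deriv j (\<lambda>y. \<omega> y I)" "Suc k"
            "\<lambda>j. - shuffle_sign {j} I" x] by (simp add: smooth smooth_partial_deriv)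
      finally show ?thesis
        using shuffle_sign_square[of "{j}" I] by (simp add: mult.assoc[symmetric])
    qed
    have "ext_deriv (cone_op k \<omega>) x I =
        (\<Sum>i\<in>I. radial_avg k (\<lambda>y. \<omega> y I) x + x $ i * ?P i I +
        (\<Sum>j\<in>-I. x $ j * (shuffle_sign {i} (I - {i}) * shuffle_sign {j} (I - {i}) *
          ?P i (insert j (I - {i})))))"
      unfolding ext_deriv_def by (rule sum.cong[OF refl inner])
    \<comment> \<open>The factor \<open>Suc k\<close> is the cardinality of \<open>I\<close>: the
      first summand does not depend on \<open>i\<close>.\<close>
    also have "\<dots> = real (Suc k) * radial_avg k (\<lambda>y. \<omega> y I) x + (\<Sum>i\<in>I. x $ i * ?P i I) +
        (\<Sum>j\<in>-I. x $ j * (\<Sum>i\<in>I. shuffle_sign {i} (I - {i}) * shuffle_sign {j} (I - {i}) *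
          ?P i (insert j (I - {i}))))"
      using True by (simp add: sum.distrib sum.swap[of _ "- I" I] sum_distrib_left)
    also have "\<dots> = real (Suc k) * radial_avg k (\<lambda>y. \<omega> y I) x +
        ((\<Sum>i\<in>I. x $ i * ?P i I) + (\<Sum>i\<in>-I. x $ i * ?P i I))"
      by (simp add: cross)
    also have "(\<Sum>i\<in>I. x $ i * ?P i I) + (\<Sum>i\<in>-I. x $ i * ?P i I) = (\<Sum>i\<in>UNIV. x $ i * ?P i I)"
      by (subst sum.union_disjoint[symmetric]) auto
    finally show ?thesis
      by (simp only: radial_avg_identity[OF smooth])
  qed
qed

section \<open>The volume form\<close>

text \<open>In the sum over splittings of \<open>I\<close>, only \<open>J = A\<close> with
  complement \<open>B\<close> survives.\<close>

lemma wedge_indicator: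
  assumes "A \<inter> B = {}"
  shows "(\<lambda>x I. if I = A then 1 else 0) \<and>\<^sub>w (\<lambda>x I. if I = B then 1 else 0) =
    (\<lambda>x I. if I = A \<union> B then shuffle_sign A B else 0)"
proof (intro ext)
  fix x :: "real ^ 'a::{finite,linorder}" and I
  have "((\<lambda>x I. if I = A then 1 else 0) \<and>\<^sub>w (\<lambda>x I. if I = B then 1 else 0)) x I =
      (\<Sum>J\<in>Pow I. if J = A then (if I - A = B then shuffle_sign A B else 0) else 0)"
    unfolding wedge_def by (rule sum.cong) auto
  also have "\<dots> = (if A \<subseteq> I \<and> I - A = B then shuffle_sign A B else 0)"
    by (simp add: sum.delta)
  also have "A \<subseteq> I \<and> I - A = B \<longleftrightarrow> I = A \<union> B"
    using assms by auto
  finally show "((\<lambda>x I. if I = A then 1 else 0) \<and>\<^sub>w (\<lambda>x I. if I = B then 1 else 0)) x I =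
      (if I = A \<union> B then shuffle_sign A B else 0)" .
qed

lemma volume_form_eq: "\<Omega> = (\<lambda>x I. if I = UNIV then 1 else 0)"
proof -
  \<comment> \<open>The order on type \<open>3\<close> is unfolded to its representatives. Since 0,
    1, 2 are already sorted there are no inversions, and both signs are 1.\<close>
  have less: "\<not> (1::3) < 0" "\<not> (2::3) < 0" "\<not> (2::3) < 1"
    by (simp_all add: less_bit1_def bit1.Rep_0 bit1.Rep_1 bit1.Rep_numeral)
  have "{(i, j). i \<in> {0::3} \<and> j \<in> {1} \<and> j < i} = {}"
    and "{(i, j). i \<in> {0::3, 1} \<and> j \<in> {2} \<and> j < i} = {}"
    using less by auto
  then have "shuffle_sign {0::3} {1} = 1" "shuffle_sign {0::3, 1} {2} = 1"
    by (simp_all only: shuffle_sign_def card.empty power_0)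
  moreover have "{0, 1} \<union> {2} = (UNIV :: 3 set)"
    using UNIV_3 by auto
  moreover have "{0} \<union> {1} = {0::3, 1}"
    by auto
  moreover have "dx (0::3) \<and>\<^sub>w dx 1 = (\<lambda>x I. if I = {0} \<union> {1} then shuffle_sign {0::3} {1} else 0)"
    unfolding dx_def by (rule wedge_indicator) simp
  moreover have "(\<lambda>x I. if I = {0::3, 1} then 1 else 0) \<and>\<^sub>w dx 2 =
      (\<lambda>x I. if I = {0, 1} \<union> {2} then shuffle_sign {0::3, 1} {2} else 0)"
    unfolding dx_def by (rule wedge_indicator) simp
  ultimately show ?thesis
    by (simp only: volume_form_def)
qed

lemma diff_form_volume_form: "diff_form 3 \<Omega>"
proof -
  have "CARD(3) = 3" by simp
  then show ?thesis
    by (auto simp: diff_form_def volume_form_eq)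
qed

lemma ext_deriv_const: "ext_deriv (\<lambda>x. c) = (\<lambda>x I. 0)"
  by (simp add: ext_deriv_def)

text \<open>Only the top component of the volume form is nonzero, which forces \<open>J\<close> to
  be the complement of \<open>K\<close>.\<close>

lemma contraction_volume_form: "(X \<rfloor> \<Omega>) x K = shuffle_sign (- K) K * X x (- K)"
proof -
  have "(X \<rfloor> \<Omega>) x K = (\<Sum>J | J \<inter> K = {}. if J = - K then shuffle_sign (- K) K * X x (- K) else 0)"
    unfolding contraction_def volume_form_eq by (rule sum.cong) auto
  then show ?thesis by (simp add: sum.delta)
qed

section \<open>Hamiltonian fields of the volume form\<close>

lemma hamiltonian_field_volume_form:
  "hamiltonian_field k \<Omega> X \<longleftrightarrow> polyvector_field k X \<and> ext_deriv (X \<rfloor> \<Omega>) = (\<lambda>x I. 0)"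
proof -
  have "ext_deriv \<Omega> = (\<lambda>x I. 0)"
    unfolding volume_form_eq by (rule ext_deriv_const)
  then have "lie_deriv X \<Omega> = ext_deriv (X \<rfloor> \<Omega>)"
    by (simp add: lie_deriv_def contraction_def)
  then show ?thesis by (simp add: hamiltonian_field_def)
qed

lemma diff_form_contraction_volume_form:
  assumes "polyvector_field k X"
  shows "diff_form (3 - k) (X \<rfloor> \<Omega>)"
  unfolding diff_form_def contraction_volume_form
proof (intro conjI allI impI)
  show "smooth (\<lambda>x. shuffle_sign (- I) I * X x (- I))" for I
    using assms by (intro smooth_mult smooth_const) (simp add: polyvector_field_def)
  show "shuffle_sign (- I) I * X x (- I) = 0" if "card I \<noteq> 3 - k" for x I
  proof -
    have "card I + card (- I) = 3"
      using card_Un_disjoint[of I "- I"] by simp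
    with that have "card (- I) \<noteq> k" by auto
    with assms show ?thesis by (simp add: polyvector_field_def)
  qed
qed

text \<open>A sign is its own inverse, so the preimage reuses the same factor. The bound on
  \<open>k\<close> guards the truncated subtraction: for larger \<open>k\<close> the degree
  \<open>3 - k\<close> would be 0, where nonzero functions live.\<close>

lemma contraction_volume_form_surj:
  assumes "diff_form (3 - k) \<omega>" "k \<le> 3"
  obtains X where "polyvector_field k X" "X \<rfloor> \<Omega> = \<omega>"
proof
  let ?X = "\<lambda>x J. shuffle_sign J (- J) * \<omega> x (- J)"
  show "polyvector_field k ?X"
    unfolding polyvector_field_def
  proof (intro conjI allI impI)
    show "smooth (\<lambda>x. ?X x J)" for J
      using assms by (intro smooth_mult smooth_const) (simp add: diff_form_def)
    show "?X x J = 0" if "card J \<noteq> k" for x J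
    proof -
      have "card J + card (- J) = 3"
        using card_Un_disjoint[of J "- J"] by simp
      with that \<open>k \<le> 3\<close> have "card (- J) \<noteq> 3 - k" by auto
      with assms show ?thesis by (simp add: diff_form_def)
    qed
  qed
  show "?X \<rfloor> \<Omega> = \<omega>"
    by (intro ext) (simp add: contraction_volume_form shuffle_sign_square mult.assoc[symmetric])
qed

text \<open>Excludes the trivial solution. Constant coefficients suffice, because the contraction
  then has constant components and is closed.\<close>

lemma nonzero_hamiltonian_field:
  assumes "k \<le> 3"
  shows "\<exists>X. hamiltonian_field k \<Omega> X \<and> X \<noteq> (\<lambda>x I. 0)"
proof (intro exI conjI)
  let ?X = "\<lambda>(x::real^3) (I::3 set). if card I = k then 1 else 0 :: real"
  \<comment> \<open>Evaluating the constant field at the origin removes the dependence on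
    \<open>x\<close>, as \<open>ext_deriv_const\<close> requires.\<close>
  have "?X \<rfloor> \<Omega> = (\<lambda>x K. shuffle_sign (- K) K * ?X 0 (- K))"
    by (intro ext) (simp add: contraction_volume_form)
  then have "ext_deriv (?X \<rfloor> \<Omega>) = (\<lambda>x I. 0)"
    by (simp add: ext_deriv_const)
  then show "hamiltonian_field k \<Omega> ?X"
    by (simp add: hamiltonian_field_volume_form polyvector_field_def)
  obtain I :: "3 set" where "card I = k"
    using assms obtain_subset_with_card_n[of k "UNIV :: 3 set"] by auto
  show "?X \<noteq> (\<lambda>x I. 0)"
  proof
    assume "?X = (\<lambda>x I. 0)"
    from fun_cong[OF fun_cong[OF this], of I] \<open>card I = k\<close> show False
      by simp
  qed
qed

text \<open>For \<open>k \<le> 2\<close> the closed form \<open>X \<rfloor> \<Omega>\<close> has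
  positive degree \<open>Suc (2 - k)\<close>, so \<open>cone_op\<close> yields a primitive.\<close>

lemma hamiltonian_field_has_hamiltonian:
  assumes "hamiltonian_field k \<Omega> X" "k \<le> 2"
  shows "\<exists>H. diff_form (2 - k) H \<and> X \<rfloor> \<Omega> = ext_deriv H"
proof -
  from assms have X: "polyvector_field k X" "ext_deriv (X \<rfloor> \<Omega>) = (\<lambda>x I. 0)"
    by (simp_all only: hamiltonian_field_volume_form)
  have "3 - k = Suc (2 - k)" using assms(2) by simp
  with diff_form_contraction_volume_form[OF X(1)]
  have form: "diff_form (Suc (2 - k)) (X \<rfloor> \<Omega>)" by (simp only:)
  show ?thesis
    using diff_form_cone_op[OF form] poincare_lemma[OF form X(2)] by metis
qed

text \<open>Surjectivity of the contraction realizes \<open>ext_deriv H\<close> by a field, and d d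
  = 0 makes that field hamiltonian.\<close>

lemma hamiltonian_has_hamiltonian_field:
  assumes "diff_form (2 - k) H" "k \<le> 2"
  shows "\<exists>X. hamiltonian_field k \<Omega> X \<and> X \<rfloor> \<Omega> = ext_deriv H"
proof -
  have "3 - k = Suc (2 - k)" using assms(2) by simp
  with diff_form_ext_deriv[OF assms(1)]
  have "diff_form (3 - k) (ext_deriv H)" by (simp only:)
  then obtain X where "polyvector_field k X" "X \<rfloor> \<Omega> = ext_deriv H"
    using assms(2) by (elim contraction_volume_form_surj) simp
  with ext_deriv_ext_deriv[OF assms(1)] show ?thesis
    by (auto simp: hamiltonian_field_volume_form)
qed

theorem theorem3:
  shows "diff_form 3 \<Omega>
    \<and> (\<exists>X. hamiltonian_field 1 \<Omega> X \<and> X \<noteq> (\<lambda>x I. 0))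
    \<and> (\<forall>X. hamiltonian_field 1 \<Omega> X \<longrightarrow> (\<exists>H. diff_form 1 H \<and> X \<rfloor> \<Omega> = ext_deriv H))
    \<and> (\<forall>H. diff_form 1 H \<longrightarrow> (\<exists>X. hamiltonian_field 1 \<Omega> X \<and> X \<rfloor> \<Omega> = ext_deriv H))
    \<and> (\<exists>X. hamiltonian_field 2 \<Omega> X \<and> X \<noteq> (\<lambda>x I. 0))
    \<and> (\<forall>X. hamiltonian_field 2 \<Omega> X \<longrightarrow> (\<exists>H. diff_form 0 H \<and> X \<rfloor> \<Omega> = ext_deriv H))
    \<and> (\<forall>H. diff_form 0 H \<longrightarrow> (\<exists>X. hamiltonian_field 2 \<Omega> X \<and> X \<rfloor> \<Omega> = ext_deriv H))"
proof (intro conjI allI impI)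
  show "diff_form 3 \<Omega>"
    by (rule diff_form_volume_form)
  show "\<exists>X. hamiltonian_field 1 \<Omega> X \<and> X \<noteq> (\<lambda>x I. 0)" "\<exists>X. hamiltonian_field 2 \<Omega> X \<and> X \<noteq> (\<lambda>x I. 0)"
    by (rule nonzero_hamiltonian_field, simp)+
  show "\<exists>H. diff_form 1 H \<and> X \<rfloor> \<Omega> = ext_deriv H" if "hamiltonian_field 1 \<Omega> X" for X
    using hamiltonian_field_has_hamiltonian[OF that] by simp
  show "\<exists>X. hamiltonian_field 1 \<Omega> X \<and> X \<rfloor> \<Omega> = ext_deriv H" if "diff_form 1 H" for H
    using hamiltonian_has_hamiltonian_field[of 1 H] that by simp
  show "\<exists>H. diff_form 0 H \<and> X \<rfloor> \<Omega> = ext_deriv H" if "hamiltonian_field 2 \<Omega> X" for X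
    using hamiltonian_field_has_hamiltonian[OF that] by simp
  show "\<exists>X. hamiltonian_field 2 \<Omega> X \<and> X \<rfloor> \<Omega> = ext_deriv H" if "diff_form 0 H" for H
    using hamiltonian_has_hamiltonian_field[of 2 H] that by simp
qed

end
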